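(* The projection map $L(\Omega,S^1)\to L(\Omega,S^1)/S^1$ admits (continuous) local sections; that is, every point of $L(\Omega,S^1)/S^1$ has an open neighborhood over which the projection has a continuous section.
   Context: $S^1=\{z\in\mathbf{C}: |z|=1\}$ is endowed with the geodesic (arc-length) metric $d$ normalized to have diameter $1$. $\Omega$ denotes an uncountable standard Borel space endowed with a non-atomic probability measure; integration against it is written $dt$. $L(\Omega,S^1)$ is the set of Borel maps $\Omega\to S^1$ modulo almost-everywhere equality, with the metric $d(f_1,f_2)=\int_\Omega d(f_1(t),f_2(t))\,dt$. $S^1$ acts on it by $(z.f)(t)=z f(t)$, and $L(\Omega,S^1)/S^1$ is the quotient space, with metric $d(\bar f_1,\bar f_2)=\inf_{z\in S^1}d(z.f_1,f_2)$. *)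

theory Defs
  imports "HOL-Probability.Probability"
begin

section \<open>Probability spaces\<close>

text \<open>A measurable space is standard Borel if its \<open>\<sigma>\<close>-algebra is the Borel
  \<open>\<sigma>\<close>-algebra of some Polish topology on the underlying set (for completely metrizable
  topologies, second countability is the same as separability).\<close>

definition standard_borel :: "'a measure \<Rightarrow> bool"
  where "standard_borel M \<longleftrightarrow>
    (\<exists>X. completely_metrizable_space X \<and> second_countable X \<and> topspace X = space M \<and>
         sets M = sigma_sets (space M) {U. openin X U})"

definition nonatomic :: "'a measure \<Rightarrow> bool"
  where "nonatomic M \<longleftrightarrow>
    (\<forall>A\<in>sets M. 0 < emeasure M A \<longrightarrow>
       (\<exists>B\<in>sets M. B \<subseteq> A \<and> 0 < emeasure M B \<and> emeasure M B < emeasure M A))"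


section \<open>The circle\<close>

text \<open>The circle is \<^term>\<open>sphere (0::complex) 1\<close>. As \<^const>\<open>Arg\<close> takes values in
  \<open>(-\<pi>, \<pi>]\<close>, the length of the shorter arc from \<open>z\<close> to \<open>w\<close> is \<open>\<bar>Arg (w / z)\<bar>\<close>; the division
  by \<open>\<pi>\<close> normalizes the diameter to \<open>1\<close>.\<close>

definition arc_dist :: "complex \<Rightarrow> complex \<Rightarrow> real"
  where "arc_dist z w = \<bar>Arg (w / z)\<bar> / pi"

lemma arc_dist_nonneg: "0 \<le> arc_dist z w"
  by (simp add: arc_dist_def)

lemma arc_dist_commute: "arc_dist z w = arc_dist w z"
proof -
  have "w / z = inverse (z / w)" by simp
  then show ?thesis unfolding arc_dist_def by (simp only: Arg_inverse) simp
qed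

lemma arc_dist_le_1: "arc_dist z w \<le> 1"
  using Arg_bounded[of "w / z"] by (simp add: arc_dist_def abs_le_iff)

lemma arc_dist_antipodal: "z \<noteq> 0 \<Longrightarrow> arc_dist z (- z) = 1"
  using Arg_eq_pi_iff[of "-1"] by (simp add: arc_dist_def)

lemma arc_dist_eq_0_iff:
  assumes "z \<in> sphere 0 1" "w \<in> sphere 0 1"
  shows "arc_dist z w = 0 \<longleftrightarrow> z = w"
proof
  assume "arc_dist z w = 0"
  then have "Arg (w / z) = 0" by (simp add: arc_dist_def)
  moreover have "w / z \<noteq> 0" "norm (w / z) = 1" using assms by (auto simp: norm_divide)
  ultimately have "w / z = 1"
    using rcis_cmod_Arg[of "w / z"] by (simp add: rcis_def)
  then show "z = w" by (metis divide_eq_1_iff)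
next
  assume "z = w" then show "arc_dist z w = 0" using assms by (auto simp: arc_dist_def)
qed

lemma arc_dist_triangle:
  assumes "x \<in> sphere 0 1" "y \<in> sphere 0 1" "z \<in> sphere 0 1"
  shows "arc_dist x z \<le> arc_dist x y + arc_dist y z"
proof -
  define a b where "a = Arg (y / x)" and "b = Arg (z / y)"
  have ne: "x \<noteq> 0" "y \<noteq> 0" "z \<noteq> 0" using assms by auto
  have n: "norm (y / x) = 1" "norm (z / y) = 1" using assms by (auto simp: norm_divide)
  have "z / x = (y / x) * (z / y)" using ne by simp
  also have "\<dots> = cis (a + b)"
    using rcis_cmod_Arg[of "y / x"] rcis_cmod_Arg[of "z / y"] n
    by (simp add: rcis_def a_def b_def flip: cis_mult)
  finally have eq: "z / x = cis (a + b)" .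
  have "\<bar>Arg (z / x)\<bar> \<le> \<bar>a\<bar> + \<bar>b\<bar>"
  proof (cases "\<bar>a\<bar> + \<bar>b\<bar> < pi")
    case True
    then have "a + b \<in> {-pi<..pi}" by auto
    then have "Arg (z / x) = a + b" by (simp add: eq Arg_cis)
    then show ?thesis by simp
  next
    case False
    then show ?thesis using Arg_bounded[of "z / x"] by linarith
  qed
  then show ?thesis
    by (simp add: arc_dist_def a_def b_def divide_right_mono flip: add_divide_distrib)
qed

lemma arc_dist_eq_arccos:
  assumes "z \<in> sphere 0 1" "w \<in> sphere 0 1"
  shows "arc_dist z w = arccos (max (-1) (min 1 (Re (w * cnj z)))) / pi"
proof -
  have nz: "norm z = 1" "norm w = 1" using assms by auto
  then have "z * cnj z = 1" using complex_norm_square[of z] by simp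
  moreover have "z \<noteq> 0" using nz by auto
  ultimately have q: "w / z = w * cnj z" by (simp add: field_simps)
  have n: "norm (w / z) = 1" using nz by (simp add: norm_divide)
  have r: "Re (w / z) = cos \<bar>Arg (w / z)\<bar>"
    using rcis_cmod_Arg[of "w / z"] n by (metis Re_rcis cos_abs_real mult_1)
  have "arccos (Re (w / z)) = \<bar>Arg (w / z)\<bar>"
    unfolding r using Arg_bounded[of "w / z"] by (intro arccos_cos) auto
  moreover have "max (-1) (min 1 (Re (w / z))) = Re (w / z)" unfolding r by simp
  ultimately show ?thesis unfolding arc_dist_def q[symmetric] by simp
qed

lemma arc_dist_rotate: "z \<noteq> 0 \<Longrightarrow> arc_dist (z * x) (z * y) = arc_dist x y"
  by (simp add: arc_dist_def)


section \<open>The space of circle-valued Borel maps\<close>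

definition circle_maps :: "'a measure \<Rightarrow> ('a \<Rightarrow> complex) set"
  where "circle_maps M = M \<rightarrow>\<^sub>M restrict_space borel (sphere 0 1)"

definition ae_eq :: "'a measure \<Rightarrow> (('a \<Rightarrow> complex) \<times> ('a \<Rightarrow> complex)) set"
  where "ae_eq M = {(f, g). f \<in> circle_maps M \<and> g \<in> circle_maps M \<and> (AE t in M. f t = g t)}"

definition L_space :: "'a measure \<Rightarrow> ('a \<Rightarrow> complex) set set"
  where "L_space M = circle_maps M // ae_eq M"

definition L_dist :: "'a measure \<Rightarrow> ('a \<Rightarrow> complex) set \<Rightarrow> ('a \<Rightarrow> complex) set \<Rightarrow> real"
  where "L_dist M F G = (LINT t|M. arc_dist ((SOME f. f \<in> F) t) ((SOME g. g \<in> G) t))"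

definition L_top :: "'a measure \<Rightarrow> ('a \<Rightarrow> complex) set topology"
  where "L_top M = Metric_space.mtopology (L_space M) (L_dist M)"

definition L_act :: "complex \<Rightarrow> ('a \<Rightarrow> complex) set \<Rightarrow> ('a \<Rightarrow> complex) set"
  where "L_act z F = (\<lambda>f t. z * f t) ` F"


section \<open>The quotient by rotations\<close>

definition L_proj :: "('a \<Rightarrow> complex) set \<Rightarrow> ('a \<Rightarrow> complex) set set"
  where "L_proj F = (\<lambda>z. L_act z F) ` sphere 0 1"

definition LQ_space :: "'a measure \<Rightarrow> ('a \<Rightarrow> complex) set set set"
  where "LQ_space M = L_proj ` L_space M"

text \<open>The value \<open>0\<close> off the carrier only serves to make the function symmetric and nonnegative
  everywhere, as \<^const>\<open>Metric_space\<close> demands.\<close>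

definition LQ_dist :: "'a measure \<Rightarrow> ('a \<Rightarrow> complex) set set \<Rightarrow> ('a \<Rightarrow> complex) set set \<Rightarrow> real"
  where "LQ_dist M A B =
    (if A \<in> LQ_space M \<and> B \<in> LQ_space M
     then INF z\<in>sphere 0 1. L_dist M (L_act z (SOME F. F \<in> A)) (SOME G. G \<in> B)
     else 0)"

definition LQ_top :: "'a measure \<Rightarrow> ('a \<Rightarrow> complex) set set topology"
  where "LQ_top M = Metric_space.mtopology (LQ_space M) (LQ_dist M)"


section \<open>Independence of representatives and metric axioms\<close>

lemma circle_maps_sphere: "f \<in> circle_maps M \<Longrightarrow> t \<in> space M \<Longrightarrow> f t \<in> sphere 0 1"
  using measurable_space[of f M "restrict_space borel (sphere 0 1)" t]
  by (simp add: circle_maps_def space_restrict_space)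

lemma circle_maps_borel: "f \<in> circle_maps M \<Longrightarrow> f \<in> borel_measurable M"
  by (simp add: circle_maps_def measurable_restrict_space2_iff)

lemma circle_maps_iff:
  "f \<in> circle_maps M \<longleftrightarrow> f \<in> borel_measurable M \<and> (\<forall>t\<in>space M. f t \<in> sphere 0 1)"
  by (auto simp: circle_maps_def measurable_restrict_space2_iff)

lemma circle_maps_rotate:
  assumes "z \<in> sphere 0 1" "f \<in> circle_maps M"
  shows "(\<lambda>t. z * f t) \<in> circle_maps M"
  using assms by (auto simp: circle_maps_iff norm_mult)

lemma equiv_ae_eq: "equiv (circle_maps M) (ae_eq M)"
proof (rule equivI)
  show "ae_eq M \<subseteq> circle_maps M \<times> circle_maps M" by (auto simp: ae_eq_def)
  show "refl_on (circle_maps M) (ae_eq M)" by (auto simp: refl_on_def ae_eq_def)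
  show "sym (ae_eq M)"
    by (rule symI) (auto simp: ae_eq_def elim: AE_mp)
  show "trans (ae_eq M)"
  proof (rule transI)
    fix f g h assume "(f, g) \<in> ae_eq M" "(g, h) \<in> ae_eq M"
    moreover from this have "AE t in M. f t = g t" "AE t in M. g t = h t"
      by (auto simp: ae_eq_def)
    then have "AE t in M. f t = h t" by eventually_elim simp
    ultimately show "(f, h) \<in> ae_eq M" by (auto simp: ae_eq_def)
  qed
qed

lemma class_some:
  assumes "f \<in> circle_maps M"
  shows "(f, SOME g. g \<in> ae_eq M `` {f}) \<in> ae_eq M"
proof -
  have "f \<in> ae_eq M `` {f}" using assms by (auto simp: ae_eq_def)
  then have "(SOME g. g \<in> ae_eq M `` {f}) \<in> ae_eq M `` {f}" by (metis someI)
  then show ?thesis by simp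
qed

lemma L_space_cases:
  assumes "F \<in> L_space M"
  obtains f where "f \<in> circle_maps M" "F = ae_eq M `` {f}"
  using assms by (auto simp: L_space_def elim: quotientE)

lemma class_in_L_space: "f \<in> circle_maps M \<Longrightarrow> ae_eq M `` {f} \<in> L_space M"
  by (simp add: L_space_def quotientI)

lemma L_dist_nonneg: "0 \<le> L_dist M F G"
  unfolding L_dist_def by (intro Bochner_Integration.integral_nonneg) (simp add: arc_dist_nonneg)

lemma L_dist_commute: "L_dist M F G = L_dist M G F"
  unfolding L_dist_def by (subst arc_dist_commute) simp

lemma measurable_arc_dist:
  assumes "f \<in> circle_maps M" "g \<in> circle_maps M"
  shows "(\<lambda>t. arc_dist (f t) (g t)) \<in> borel_measurable M"
proof -
  have [measurable]: "f \<in> borel_measurable M" "g \<in> borel_measurable M"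
    using assms by (auto intro: circle_maps_borel)
  have [measurable]: "(\<lambda>x. arccos (max (-1) (min 1 x))) \<in> borel_measurable borel"
    by (intro borel_measurable_continuous_onI continuous_intros) auto
  have "(\<lambda>z. Re z) \<in> borel_measurable borel" "(\<lambda>z. cnj z) \<in> borel_measurable borel"
    by (intro borel_measurable_continuous_onI continuous_intros)+
  note [measurable] = this
  have "(\<lambda>t. arccos (max (-1) (min 1 (Re (g t * cnj (f t))))) / pi) \<in> borel_measurable M"
    by measurable
  moreover have "arccos (max (-1) (min 1 (Re (g t * cnj (f t))))) / pi = arc_dist (f t) (g t)"
    if "t \<in> space M" for t
    using that assms by (intro arc_dist_eq_arccos[symmetric] circle_maps_sphere)
  ultimately show ?thesis using measurable_cong by (metis (no_types, lifting))
qed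

lemma integrable_arc_dist:
  assumes "prob_space M" "f \<in> circle_maps M" "g \<in> circle_maps M"
  shows "integrable M (\<lambda>t. arc_dist (f t) (g t))"
proof -
  interpret prob_space M by fact
  show ?thesis
    using assms by (intro integrable_const_bound[where B = 1] measurable_arc_dist)
      (auto simp: arc_dist_nonneg arc_dist_le_1)
qed

lemma L_dist_class:
  assumes "f \<in> circle_maps M" "g \<in> circle_maps M"
  shows "L_dist M (ae_eq M `` {f}) (ae_eq M `` {g}) = (LINT t|M. arc_dist (f t) (g t))"
proof -
  define f' g' where "f' = (SOME h. h \<in> ae_eq M `` {f})" and "g' = (SOME h. h \<in> ae_eq M `` {g})"
  have *: "(f, f') \<in> ae_eq M" "(g, g') \<in> ae_eq M"
    unfolding f'_def g'_def by (rule class_some, fact)+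
  then have ae: "AE t in M. f t = f' t" "AE t in M. g t = g' t"
    and c: "f' \<in> circle_maps M" "g' \<in> circle_maps M"
    by (auto simp: ae_eq_def)
  show ?thesis
    unfolding L_dist_def f'_def[symmetric] g'_def[symmetric]
  proof (rule integral_cong_AE)
    show "AE t in M. arc_dist (f' t) (g' t) = arc_dist (f t) (g t)"
      using ae by eventually_elim simp
  qed (use assms c in \<open>auto intro: measurable_arc_dist\<close>)
qed

lemma L_act_class:
  assumes "z \<in> sphere 0 1" "f \<in> circle_maps M"
  shows "L_act z (ae_eq M `` {f}) = ae_eq M `` {\<lambda>t. z * f t}"
proof -
  have z: "z \<noteq> 0" "inverse z \<in> sphere 0 1" using assms by (auto simp: norm_inverse)
  show ?thesis
  proof (intro equalityI subsetI)
    fix h assume "h \<in> L_act z (ae_eq M `` {f})"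
    then obtain g where g: "(f, g) \<in> ae_eq M" "h = (\<lambda>t. z * g t)" by (auto simp: L_act_def)
    moreover from g have "AE t in M. f t = g t" by (auto simp: ae_eq_def)
    then have "AE t in M. z * f t = h t" by eventually_elim (simp add: g(2))
    ultimately show "h \<in> ae_eq M `` {\<lambda>t. z * f t}"
      using circle_maps_rotate[OF assms(1)] by (auto simp: ae_eq_def)
  next
    fix h assume "h \<in> ae_eq M `` {\<lambda>t. z * f t}"
    then have h: "h \<in> circle_maps M" "AE t in M. z * f t = h t" by (auto simp: ae_eq_def)
    from h(2) have "AE t in M. f t = inverse z * h t" by eventually_elim (use z(1) in \<open>auto simp: field_simps\<close>)
    then have "(\<lambda>t. inverse z * h t) \<in> ae_eq M `` {f}"
      using circle_maps_rotate[OF z(2) h(1)] assms(2) by (auto simp: ae_eq_def)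
    then have "(\<lambda>t. z * (inverse z * h t)) \<in> L_act z (ae_eq M `` {f})"
      unfolding L_act_def by (rule rev_image_eqI) simp
    then show "h \<in> L_act z (ae_eq M `` {f})" using z(1) by (simp add: field_simps)
  qed
qed

lemma Metric_space_L:
  assumes "prob_space M"
  shows "Metric_space (L_space M) (L_dist M)"
proof
  show "0 \<le> L_dist M F G" for F G by (rule L_dist_nonneg)
  show "L_dist M F G = L_dist M G F" for F G by (rule L_dist_commute)
next
  fix F G assume "F \<in> L_space M" "G \<in> L_space M"
  then obtain f g where f: "f \<in> circle_maps M" "F = ae_eq M `` {f}"
    and g: "g \<in> circle_maps M" "G = ae_eq M `` {g}"
    by (metis L_space_cases)
  have "L_dist M F G = 0 \<longleftrightarrow> (LINT t|M. arc_dist (f t) (g t)) = 0"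
    using f g by (simp add: L_dist_class)
  also have "\<dots> \<longleftrightarrow> (AE t in M. arc_dist (f t) (g t) = 0)"
    using integrable_arc_dist[OF assms f(1) g(1)]
    by (intro integral_nonneg_eq_0_iff_AE) (auto simp: arc_dist_nonneg)
  also have "\<dots> \<longleftrightarrow> (AE t in M. f t = g t)"
    by (intro AE_cong arc_dist_eq_0_iff circle_maps_sphere[OF f(1)] circle_maps_sphere[OF g(1)])
  also have "\<dots> \<longleftrightarrow> (f, g) \<in> ae_eq M" using f g by (simp add: ae_eq_def)
  also have "\<dots> \<longleftrightarrow> F = G" using eq_equiv_class_iff[OF equiv_ae_eq f(1) g(1)] f g by simp
  finally show "L_dist M F G = 0 \<longleftrightarrow> F = G" .
next
  fix F G H assume "F \<in> L_space M" "G \<in> L_space M" "H \<in> L_space M"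
  then obtain f g h where f: "f \<in> circle_maps M" "F = ae_eq M `` {f}"
    and g: "g \<in> circle_maps M" "G = ae_eq M `` {g}"
    and h: "h \<in> circle_maps M" "H = ae_eq M `` {h}"
    by (metis L_space_cases)
  note i = integrable_arc_dist[OF assms]
  have "(LINT t|M. arc_dist (f t) (h t)) \<le> (LINT t|M. arc_dist (f t) (g t) + arc_dist (g t) (h t))"
    by (intro integral_mono i Bochner_Integration.integrable_add f(1) g(1) h(1) arc_dist_triangle
        circle_maps_sphere[OF f(1)] circle_maps_sphere[OF g(1)] circle_maps_sphere[OF h(1)])
  also have "\<dots> = (LINT t|M. arc_dist (f t) (g t)) + (LINT t|M. arc_dist (g t) (h t))"
    by (intro Bochner_Integration.integral_add i f(1) g(1) h(1))
  finally show "L_dist M F H \<le> L_dist M F G + L_dist M G H"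
    using f g h by (simp add: L_dist_class)
qed

lemma L_act_in_L_space: "z \<in> sphere 0 1 \<Longrightarrow> F \<in> L_space M \<Longrightarrow> L_act z F \<in> L_space M"
  by (metis L_space_cases L_act_class class_in_L_space circle_maps_rotate)

lemma L_act_1: "L_act 1 F = F"
  by (simp add: L_act_def)

lemma L_act_L_act: "L_act z (L_act w F) = L_act (z * w) F"
  by (simp add: L_act_def image_image mult.assoc)

lemma L_dist_L_act:
  assumes "z \<in> sphere 0 1" "F \<in> L_space M" "G \<in> L_space M"
  shows "L_dist M (L_act z F) (L_act z G) = L_dist M F G"
proof -
  obtain f g where f: "f \<in> circle_maps M" "F = ae_eq M `` {f}"
    and g: "g \<in> circle_maps M" "G = ae_eq M `` {g}"
    by (metis assms(2,3) L_space_cases)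
  have "z \<noteq> 0" using assms(1) by auto
  then show ?thesis
    using f g assms(1) by (simp add: L_act_class L_dist_class circle_maps_rotate arc_dist_rotate)
qed

lemma L_dist_L_act_same:
  assumes "prob_space M" "z \<in> sphere 0 1" "w \<in> sphere 0 1" "F \<in> L_space M"
  shows "L_dist M (L_act z F) (L_act w F) = arc_dist z w"
proof -
  interpret prob_space M by fact
  obtain f where f: "f \<in> circle_maps M" "F = ae_eq M `` {f}"
    by (metis assms(4) L_space_cases)
  have "L_dist M (L_act z F) (L_act w F) = (LINT t|M. arc_dist (z * f t) (w * f t))"
    using f assms(2,3) by (simp add: L_act_class L_dist_class circle_maps_rotate)
  also have "\<dots> = (LINT t|M. arc_dist z w)"
  proof (rule Bochner_Integration.integral_cong)
    fix t assume "t \<in> space M"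
    then have "f t \<noteq> 0" using circle_maps_sphere[OF f(1)] by fastforce
    then show "arc_dist (z * f t) (w * f t) = arc_dist z w"
      using arc_dist_rotate[of "f t" z w] by (simp add: mult.commute)
  qed simp
  finally show ?thesis by (simp add: prob_space)
qed

lemma L_proj_L_act:
  assumes "z \<in> sphere 0 1"
  shows "L_proj (L_act z F) = L_proj F"
proof -
  have "(\<lambda>w. w * z) ` sphere 0 1 = sphere 0 1"
  proof (intro equalityI subsetI)
    fix u assume "u \<in> sphere (0::complex) 1"
    then have "u / z \<in> sphere 0 1" "u = u / z * z" using assms by (auto simp: norm_divide)
    then show "u \<in> (\<lambda>w. w * z) ` sphere 0 1" by blast
  qed (use assms in \<open>auto simp: norm_mult\<close>)
  then have "(\<lambda>w. L_act w F) ` sphere 0 1 = (\<lambda>w. L_act w F) ` (\<lambda>w. w * z) ` sphere 0 1" by simp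
  then show ?thesis
    by (simp only: L_proj_def L_act_L_act image_image)
qed

lemma L_proj_some:
  obtains z where "z \<in> sphere 0 1" "(SOME G. G \<in> L_proj F) = L_act z F"
proof -
  have "L_act 1 F \<in> L_proj F" unfolding L_proj_def by (rule imageI) simp
  then have "(SOME G. G \<in> L_proj F) \<in> L_proj F" by (metis someI)
  then show thesis using that by (auto simp: L_proj_def)
qed

lemma LQ_dist_proj:
  assumes "F \<in> L_space M" "G \<in> L_space M"
  shows "LQ_dist M (L_proj F) (L_proj G) = (INF z\<in>sphere 0 1. L_dist M (L_act z F) G)"
proof -
  obtain a where a: "a \<in> sphere 0 1" "(SOME H. H \<in> L_proj F) = L_act a F"
    by (rule L_proj_some)
  obtain b where b: "b \<in> sphere 0 1" "(SOME H. H \<in> L_proj G) = L_act b G"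
    by (rule L_proj_some)
  have ne: "a \<noteq> 0" "b \<noteq> 0" using a b by auto
  have shift: "L_dist M (L_act z (L_act a F)) (L_act b G) = L_dist M (L_act (z * a / b) F) G"
    if "z \<in> sphere 0 1" for z
  proof -
    have s: "z * a / b \<in> sphere 0 1" using that a b by (simp add: norm_mult norm_divide)
    have "L_act z (L_act a F) = L_act b (L_act (z * a / b) F)"
      using ne by (simp add: L_act_L_act)
    then show ?thesis using L_dist_L_act[OF b(1) L_act_in_L_space[OF s assms(1)] assms(2)] by simp
  qed
  have "(\<lambda>z. L_dist M (L_act z (L_act a F)) (L_act b G)) ` sphere 0 1 =
        (\<lambda>z. L_dist M (L_act z F) G) ` sphere 0 1" (is "?A = ?B")
  proof (intro equalityI subsetI)
    fix r assume "r \<in> ?A"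
    then obtain z where "z \<in> sphere 0 1" "r = L_dist M (L_act (z * a / b) F) G"
      using shift by auto
    then show "r \<in> ?B" using a b by (intro image_eqI[where x = "z * a / b"])
        (auto simp: norm_mult norm_divide)
  next
    fix r assume "r \<in> ?B"
    then obtain z where z: "z \<in> sphere 0 1" "r = L_dist M (L_act z F) G" by auto
    then have s: "z * b / a \<in> sphere 0 1" using a b by (simp add: norm_mult norm_divide)
    have "r = L_dist M (L_act (z * b / a) (L_act a F)) (L_act b G)"
      using z(2) ne by (simp add: shift[OF s])
    then show "r \<in> ?A" using s by blast
  qed
  then show ?thesis
    using assms by (simp add: LQ_dist_def LQ_space_def a(2) b(2))
qed

lemma LQ_dist_attained:
  assumes "prob_space M" "F \<in> L_space M" "G \<in> L_space M"
  obtains z where "z \<in> sphere 0 1" "LQ_dist M (L_proj F) (L_proj G) = L_dist M (L_act z F) G"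
proof -
  interpret L: Metric_space "L_space M" "L_dist M" by (rule Metric_space_L) fact
  let ?\<phi> = "\<lambda>z. L_dist M (L_act z F) G"
  have "continuous_on (sphere 0 1) ?\<phi>"
    unfolding continuous_on_def
  proof
    fix z :: complex assume z: "z \<in> sphere 0 1"
    have "continuous_on (sphere 0 1) (\<lambda>w. arccos (max (-1) (min 1 (Re (w * cnj z)))) / pi)"
      by (intro continuous_intros) auto
    then have "continuous_on (sphere 0 1) (\<lambda>w. arc_dist z w)"
      using z by (subst continuous_on_cong[OF refl arc_dist_eq_arccos]) auto
    then have "((\<lambda>w. arc_dist z w) \<longlongrightarrow> arc_dist z z) (at z within sphere 0 1)"
      using z by (auto simp: continuous_on_def)
    then have lim: "((\<lambda>w. arc_dist z w) \<longlongrightarrow> 0) (at z within sphere 0 1)"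
      using z arc_dist_eq_0_iff[of z z] by simp
    have bound: "dist (?\<phi> w) (?\<phi> z) \<le> arc_dist z w" if "w \<in> sphere 0 1" for w
    proof -
      have zF: "L_act z F \<in> L_space M" "L_act w F \<in> L_space M"
        using z that assms by (auto intro!: L_act_in_L_space)
      show ?thesis
        using L.triangle[OF zF(1) zF(2) assms(3)] L.triangle[OF zF(2) zF(1) assms(3)]
          L_dist_L_act_same[OF assms(1) z that assms(2)] L_dist_commute[of M "L_act z F" "L_act w F"]
        by (auto simp: dist_real_def abs_le_iff)
    qed
    show "(?\<phi> \<longlongrightarrow> ?\<phi> z) (at z within sphere 0 1)"
      by (rule metric_tendsto_imp_tendsto[OF lim])
        (use bound arc_dist_nonneg in \<open>auto simp: eventually_at_filter\<close>)
  qed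
  moreover have "sphere (0::complex) 1 \<noteq> {}" by simp
  ultimately obtain z where z: "z \<in> sphere 0 1" "\<And>w. w \<in> sphere 0 1 \<Longrightarrow> ?\<phi> z \<le> ?\<phi> w"
    using continuous_attains_inf[OF compact_sphere] by metis
  then have "(INF w\<in>sphere 0 1. ?\<phi> w) = ?\<phi> z"
    by (intro cInf_eq_minimum) (auto simp del: mem_sphere_0)
  then show thesis using that z(1) LQ_dist_proj[OF assms(2,3)] by simp
qed

lemma LQ_dist_le:
  assumes "F \<in> L_space M" "G \<in> L_space M" "z \<in> sphere 0 1"
  shows "LQ_dist M (L_proj F) (L_proj G) \<le> L_dist M (L_act z F) G"
  unfolding LQ_dist_proj[OF assms(1,2)]
  by (rule cINF_lower) (use assms in \<open>auto intro!: bdd_belowI2[where m = 0] simp: L_dist_nonneg\<close>)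

lemma Metric_space_LQ:
  assumes P: "prob_space M"
  shows "Metric_space (LQ_space M) (LQ_dist M)"
proof -
  interpret L: Metric_space "L_space M" "L_dist M" by (rule Metric_space_L) fact
  have LQ_nonneg: "0 \<le> LQ_dist M A B" for A B
    unfolding LQ_dist_def by (auto intro!: cINF_greatest simp: L_dist_nonneg)
  have sym_le: "LQ_dist M A B \<le> LQ_dist M B A"
    if AB: "A \<in> LQ_space M" "B \<in> LQ_space M" for A B
  proof -
    obtain F G where F: "F \<in> L_space M" "A = L_proj F" and G: "G \<in> L_space M" "B = L_proj G"
      using AB by (auto simp: LQ_space_def)
    obtain z where z: "z \<in> sphere 0 1" "LQ_dist M B A = L_dist M (L_act z G) F"
      using LQ_dist_attained[OF P G(1) F(1)] F G by metis
    have "z \<noteq> 0" using z(1) by auto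
    then have iz: "inverse z \<in> sphere 0 1" "inverse z * z = 1" using z(1) by (auto simp: norm_inverse)
    have "L_dist M (L_act z G) F = L_dist M (L_act (inverse z) (L_act z G)) (L_act (inverse z) F)"
      using iz z F G by (intro L_dist_L_act[symmetric] L_act_in_L_space)
    also have "\<dots> = L_dist M (L_act (inverse z) F) G"
      using iz by (simp add: L_act_L_act L_act_1 L_dist_commute)
    finally show ?thesis using LQ_dist_le[OF F(1) G(1) iz(1)] F G z by simp
  qed
  show ?thesis
  proof
    fix A B :: "('a \<Rightarrow> complex) set set"
    show "0 \<le> LQ_dist M A B" by (rule LQ_nonneg)
    show "LQ_dist M A B = LQ_dist M B A"
      using sym_le[of A B] sym_le[of B A]
      by (cases "A \<in> LQ_space M \<and> B \<in> LQ_space M") (auto simp: LQ_dist_def[of M])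
  next
    fix A B assume AB: "A \<in> LQ_space M" "B \<in> LQ_space M"
    obtain F G where F: "F \<in> L_space M" "A = L_proj F" and G: "G \<in> L_space M" "B = L_proj G"
      using AB by (auto simp: LQ_space_def)
    show "LQ_dist M A B = 0 \<longleftrightarrow> A = B"
    proof
      assume "LQ_dist M A B = 0"
      then obtain z where z: "z \<in> sphere 0 1" "L_dist M (L_act z F) G = 0"
        using LQ_dist_attained[OF P F(1) G(1)] F G by metis
      then have "L_act z F = G" using L.zero[OF L_act_in_L_space[OF z(1) F(1)] G(1)] by simp
      then show "A = B" using L_proj_L_act[OF z(1)] F G by metis
    next
      assume AB: "A = B"
      have "LQ_dist M (L_proj F) (L_proj F) \<le> L_dist M (L_act 1 F) F"
        by (rule LQ_dist_le[OF F(1) F(1)]) simp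
      also have "L_dist M (L_act 1 F) F = 0" using F(1) by (simp add: L_act_1)
      finally have "LQ_dist M A B \<le> 0" using AB F(2) by simp
      moreover have "0 \<le> LQ_dist M A B" by (rule LQ_nonneg)
      ultimately show "LQ_dist M A B = 0" by simp
    qed
  next
    fix A B C assume ABC: "A \<in> LQ_space M" "B \<in> LQ_space M" "C \<in> LQ_space M"
    then obtain F G H where F: "F \<in> L_space M" "A = L_proj F"
      and G: "G \<in> L_space M" "B = L_proj G" and H: "H \<in> L_space M" "C = L_proj H"
      by (auto simp: LQ_space_def)
    obtain z where z: "z \<in> sphere 0 1" "LQ_dist M A B = L_dist M (L_act z F) G"
      using LQ_dist_attained[OF P F(1) G(1)] F G by metis
    obtain w where w: "w \<in> sphere 0 1" "LQ_dist M B C = L_dist M (L_act w G) H"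
      using LQ_dist_attained[OF P G(1) H(1)] G H by metis
    have zF: "L_act z F \<in> L_space M" and wG: "L_act w G \<in> L_space M"
      using z w F G by (auto intro!: L_act_in_L_space)
    have wz: "w * z \<in> sphere 0 1" using w z by (simp add: norm_mult)
    have "LQ_dist M A C \<le> L_dist M (L_act (w * z) F) H"
      using LQ_dist_le[OF F(1) H(1) wz] F H by simp
    also have "\<dots> = L_dist M (L_act w (L_act z F)) H" by (simp add: L_act_L_act)
    also have "\<dots> \<le> L_dist M (L_act w (L_act z F)) (L_act w G) + L_dist M (L_act w G) H"
      using w zF wG H by (blast intro: L.triangle L_act_in_L_space)
    also have "\<dots> = LQ_dist M A B + LQ_dist M B C"
      using L_dist_L_act[OF w(1) zF G(1)] z w by simp
    finally show "LQ_dist M A C \<le> LQ_dist M A B + LQ_dist M B C" .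
  qed
qed

end

theory Submission
  imports Defs
begin

text \<open>Fix a base point \<open>G\<close> and correlate any \<open>F\<close> with it: \<open>c F = \<integral> f(t) * cnj (g(t)) dt\<close> is a
  complex number that depends continuously on \<open>F\<close>, and rotating \<open>F\<close> by \<open>z\<close> multiplies
  it by \<open>z\<close> (\<open>correlation_L_act\<close>). So \<open>c\<close> measures the phase of \<open>F\<close> relative to \<open>G\<close> wherever it does
  not vanish: each orbit on which \<open>c\<close> is nonzero contains an element with positive correlation,
  and selecting it gives a section. The orbits in question form an open set, and the orbit of \<open>G\<close>
  is among them because \<open>c G = 1\<close>.

  Continuity rests on two facts. The correlation is \<open>\<pi>\<close>-Lipschitz (\<open>correlation_lipschitz\<close>),
  because a chord is no longer than its arc. And nearby orbits have nearby representatives: the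
  infimum that defines the quotient metric is attained, whatever element of the target orbit is
  prescribed (\<open>LQ_dist_attained_by_elements\<close>). If the orbit of \<open>F\<close> is close to that of
  \<open>F'\<close>, both normalized to positive correlation, then some \<open>z.F\<close> is close to \<open>F'\<close>, so the
  correlation of \<open>z.F\<close>, whose argument is that of \<open>z\<close>, is close to a positive number; hence \<open>z\<close> is
  close to \<open>1\<close> and \<open>F\<close> itself is close to \<open>F'\<close>.\<close>

section \<open>Correlation with a base point\<close>

definition correlation :: "'a measure \<Rightarrow> ('a \<Rightarrow> complex) set \<Rightarrow> ('a \<Rightarrow> complex) set \<Rightarrow> complex"
  where "correlation M F G = (LINT t|M. (SOME f. f \<in> F) t * cnj ((SOME g. g \<in> G) t))"

text \<open>A chord is no longer than its arc; the factor \<open>\<pi>\<close> undoes the normalization of the metric.\<close>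

lemma norm_diff_le_arc_dist:
  assumes "z \<in> sphere 0 1" "w \<in> sphere 0 1"
  shows "norm (z - w) \<le> pi * arc_dist z w"
proof -
  have nz: "norm z = 1" "z \<noteq> 0" using assms by auto
  have "norm (w / z) = 1" using assms by (simp add: norm_divide)
  then have "w / z = cis (Arg (w / z))"
    using rcis_cmod_Arg[of "w / z"] by (simp add: rcis_def)
  then have "norm (w / z - 1) \<le> \<bar>Arg (w / z)\<bar>"
    using iexp_approx1[of "Arg (w / z)" 0] by (simp add: cis_conv_exp)
  moreover have "norm (z - w) = norm (w / z - 1)"
  proof -
    have "w - z = z * (w / z - 1)" using nz by (simp add: field_simps)
    then show ?thesis using nz by (metis norm_minus_commute norm_mult mult_1)
  qed
  ultimately show ?thesis by (simp add: arc_dist_def)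
qed

lemma integrable_circle_maps_prod:
  assumes "prob_space M" "f \<in> circle_maps M" "g \<in> circle_maps M"
  shows "integrable M (\<lambda>t. f t * cnj (g t))"
proof -
  interpret prob_space M by fact
  have [measurable]: "f \<in> borel_measurable M" "g \<in> borel_measurable M"
    using assms by (auto intro: circle_maps_borel)
  have [measurable]: "cnj \<in> borel_measurable borel"
    by (intro borel_measurable_continuous_onI continuous_intros)
  have "norm (f t * cnj (g t)) \<le> 1" if "t \<in> space M" for t
    using circle_maps_sphere[OF assms(2) that] circle_maps_sphere[OF assms(3) that]
    by (simp add: norm_mult)
  then show ?thesis
    by (intro integrable_const_bound[where B = 1]) auto
qed

lemma correlation_class:
  assumes "f \<in> circle_maps M" "g \<in> circle_maps M"
  shows "correlation M (ae_eq M `` {f}) (ae_eq M `` {g}) = (LINT t|M. f t * cnj (g t))"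
proof -
  define f' g' where "f' = (SOME h. h \<in> ae_eq M `` {f})" and "g' = (SOME h. h \<in> ae_eq M `` {g})"
  have "(f, f') \<in> ae_eq M" "(g, g') \<in> ae_eq M"
    unfolding f'_def g'_def by (rule class_some, fact)+
  then have ae: "AE t in M. f t = f' t" "AE t in M. g t = g' t"
    and c: "f' \<in> circle_maps M" "g' \<in> circle_maps M"
    by (auto simp: ae_eq_def)
  have [measurable]: "f \<in> borel_measurable M" "g \<in> borel_measurable M"
    "f' \<in> borel_measurable M" "g' \<in> borel_measurable M"
    using assms c by (auto intro: circle_maps_borel)
  have [measurable]: "cnj \<in> borel_measurable borel"
    by (intro borel_measurable_continuous_onI continuous_intros)
  show ?thesis
    unfolding correlation_def f'_def[symmetric] g'_def[symmetric]
  proof (rule integral_cong_AE)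
    show "AE t in M. f' t * cnj (g' t) = f t * cnj (g t)"
      using ae by eventually_elim simp
  qed measurable
qed

lemma correlation_L_act:
  assumes "z \<in> sphere 0 1" "F \<in> L_space M" "G \<in> L_space M"
  shows "correlation M (L_act z F) G = z * correlation M F G"
proof -
  obtain f g where "f \<in> circle_maps M" "F = ae_eq M `` {f}"
    and "g \<in> circle_maps M" "G = ae_eq M `` {g}"
    by (metis assms(2,3) L_space_cases)
  then show ?thesis
    using assms(1) by (simp add: L_act_class correlation_class circle_maps_rotate mult.assoc)
qed

lemma correlation_self:
  assumes "prob_space M" "G \<in> L_space M"
  shows "correlation M G G = 1"
proof -
  interpret prob_space M by fact
  obtain g where g: "g \<in> circle_maps M" "G = ae_eq M `` {g}"
    by (metis assms(2) L_space_cases)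
  have "correlation M G G = (LINT t|M. g t * cnj (g t))"
    using g by (simp add: correlation_class)
  also have "\<dots> = (LINT t|M. 1)"
  proof (rule Bochner_Integration.integral_cong)
    fix t assume "t \<in> space M"
    then have "norm (g t) = 1" using circle_maps_sphere[OF g(1)] by auto
    then show "g t * cnj (g t) = 1" using complex_norm_square[of "g t"] by simp
  qed simp
  finally show ?thesis by (simp add: prob_space)
qed

lemma correlation_lipschitz:
  assumes "prob_space M" "F \<in> L_space M" "H \<in> L_space M" "G \<in> L_space M"
  shows "norm (correlation M F G - correlation M H G) \<le> pi * L_dist M F H"
proof -
  obtain f h g where f: "f \<in> circle_maps M" "F = ae_eq M `` {f}"
    and h: "h \<in> circle_maps M" "H = ae_eq M `` {h}"
    and g: "g \<in> circle_maps M" "G = ae_eq M `` {g}"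
    by (metis assms(2-4) L_space_cases)
  note i = integrable_circle_maps_prod[OF assms(1)]
  have "correlation M F G - correlation M H G = (LINT t|M. f t * cnj (g t) - h t * cnj (g t))"
    using f g h i by (simp add: correlation_class Bochner_Integration.integral_diff)
  also have "norm \<dots> \<le> (LINT t|M. norm (f t * cnj (g t) - h t * cnj (g t)))"
    by (rule integral_norm_bound)
  also have "\<dots> \<le> (LINT t|M. pi * arc_dist (f t) (h t))"
  proof (rule integral_mono)
    fix t assume t: "t \<in> space M"
    have "norm (g t) = 1" using circle_maps_sphere[OF g(1) t] by simp
    then have "norm (f t * cnj (g t) - h t * cnj (g t)) = norm (f t - h t)"
      by (simp add: norm_mult flip: left_diff_distrib)
    also have "\<dots> \<le> pi * arc_dist (f t) (h t)"
      by (intro norm_diff_le_arc_dist circle_maps_sphere[OF f(1) t] circle_maps_sphere[OF h(1) t])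
    finally show "norm (f t * cnj (g t) - h t * cnj (g t)) \<le> pi * arc_dist (f t) (h t)" .
  qed (use f g h i integrable_arc_dist[OF assms(1) f(1) h(1)] in auto)
  also have "\<dots> = pi * L_dist M F H" using f h by (simp add: L_dist_class)
  finally show ?thesis .
qed

section \<open>Nearby representatives of nearby orbits\<close>

lemma LQ_space_elem:
  assumes "A \<in> LQ_space M" "F \<in> A"
  shows "F \<in> L_space M" "A = L_proj F"
proof -
  obtain F' where F': "F' \<in> L_space M" "A = L_proj F'"
    using assms(1) by (auto simp: LQ_space_def)
  then obtain z where z: "z \<in> sphere 0 1" "F = L_act z F'"
    using assms(2) by (auto simp: L_proj_def)
  show "F \<in> L_space M" using z F' by (simp add: L_act_in_L_space del: mem_sphere_0)
  show "A = L_proj F" using z F' by (simp add: L_proj_L_act del: mem_sphere_0)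
qed

lemma LQ_space_nonempty: "A \<in> LQ_space M \<Longrightarrow> A \<noteq> {}"
  by (auto simp: LQ_space_def L_proj_def)

text \<open>This replaces the projection's being an open map: a small distance between two orbits is
  realized by rotating one prescribed representative towards another.\<close>

lemma LQ_dist_attained_by_elements:
  assumes "prob_space M" "A \<in> LQ_space M" "B \<in> LQ_space M" "F \<in> A" "H \<in> B"
  obtains z where "z \<in> sphere 0 1" "LQ_dist M A B = L_dist M (L_act z F) H"
  using LQ_dist_attained[OF assms(1) LQ_space_elem(1)[OF assms(2,4)] LQ_space_elem(1)[OF assms(3,5)]]
    LQ_space_elem(2)[OF assms(2,4)] LQ_space_elem(2)[OF assms(3,5)] by metis

section \<open>The section over the correlated orbits\<close>

definition correlated_orbits :: "'a measure \<Rightarrow> ('a \<Rightarrow> complex) set \<Rightarrow> ('a \<Rightarrow> complex) set set set"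
  where "correlated_orbits M G = {A \<in> LQ_space M. \<forall>F\<in>A. correlation M F G \<noteq> 0}"

text \<open>Over the ball of radius \<open>\<bar>c H\<bar> / \<pi>\<close> around the orbit of \<open>H\<close>, the Lipschitz bound keeps the
  correlation of a suitable representative away from \<open>0\<close>, and rotations preserve that.\<close>

lemma openin_correlated_orbits:
  assumes P: "prob_space M" and G: "G \<in> L_space M"
  shows "openin (LQ_top M) (correlated_orbits M G)"
proof -
  interpret Q: Metric_space "LQ_space M" "LQ_dist M" by (rule Metric_space_LQ) fact
  have "\<exists>r>0. Q.mball B r \<subseteq> correlated_orbits M G" if "B \<in> correlated_orbits M G" for B
  proof -
    have B: "B \<in> LQ_space M" using that by (simp add: correlated_orbits_def)
    then obtain H where H: "H \<in> B" using LQ_space_nonempty by blast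
    then have c: "correlation M H G \<noteq> 0" using that by (simp add: correlated_orbits_def)
    have "correlation M F G \<noteq> 0"
      if A: "A \<in> LQ_space M" and d: "LQ_dist M B A < norm (correlation M H G) / pi" and F: "F \<in> A"
      for A F
    proof
      assume 0: "correlation M F G = 0"
      obtain z where z: "z \<in> sphere 0 1" "LQ_dist M A B = L_dist M (L_act z F) H"
        by (rule LQ_dist_attained_by_elements[OF P A B F H])
      have FL: "F \<in> L_space M" by (rule LQ_space_elem(1)[OF A F])
      have "norm (correlation M (L_act z F) G - correlation M H G) \<le> pi * LQ_dist M B A"
        using correlation_lipschitz[OF P L_act_in_L_space[OF z(1) FL] LQ_space_elem(1)[OF B H] G] z(2)
        by (simp add: Q.commute)
      also have "\<dots> < norm (correlation M H G)" using d by (simp add: field_simps)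
      finally show False using correlation_L_act[OF z(1) FL G] 0 by simp
    qed
    then have "Q.mball B (norm (correlation M H G) / pi) \<subseteq> correlated_orbits M G"
      by (auto simp: correlated_orbits_def)
    then show ?thesis using c by (intro exI[of _ "norm (correlation M H G) / pi"]) auto
  qed
  then show ?thesis
    unfolding LQ_top_def Q.openin_mtopology by (auto simp: correlated_orbits_def)
qed

text \<open>Positivity of the correlation pins down a unique element of a correlated orbit, so \<open>SOME\<close>
  is no real choice.\<close>

definition positive_representative ::
    "'a measure \<Rightarrow> ('a \<Rightarrow> complex) set \<Rightarrow> ('a \<Rightarrow> complex) set set \<Rightarrow> ('a \<Rightarrow> complex) set"
  where "positive_representative M G A =
    (SOME F. F \<in> A \<and> (\<exists>r>0. correlation M F G = complex_of_real r))"

lemma positive_representative: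
  assumes G: "G \<in> L_space M" and A: "A \<in> correlated_orbits M G"
  shows "positive_representative M G A \<in> A"
    and "\<exists>r>0. correlation M (positive_representative M G A) G = complex_of_real r"
proof -
  have AQ: "A \<in> LQ_space M" using A by (simp add: correlated_orbits_def)
  then obtain F where F: "F \<in> A" using LQ_space_nonempty by blast
  then have c: "correlation M F G \<noteq> 0" using A by (simp add: correlated_orbits_def)
  (* Rotating by the inverse of the phase of the correlation makes it equal to its modulus. *)
  define z where "z = inverse (sgn (correlation M F G))"
  have z: "z \<in> sphere 0 1" using c by (simp add: z_def norm_inverse norm_sgn)
  have "correlation M (L_act z F) G = z * correlation M F G"
    by (rule correlation_L_act[OF z LQ_space_elem(1)[OF AQ F] G])
  also have "\<dots> = norm (correlation M F G)"
    using c by (simp add: z_def sgn_eq)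
  finally have "\<exists>r>0. correlation M (L_act z F) G = complex_of_real r" using c by auto
  moreover have "L_act z F \<in> A" using z LQ_space_elem(2)[OF AQ F] by (auto simp: L_proj_def)
  ultimately have "\<exists>F. F \<in> A \<and> (\<exists>r>0. correlation M F G = complex_of_real r)" by blast
  from someI_ex[OF this] show "positive_representative M G A \<in> A"
    and "\<exists>r>0. correlation M (positive_representative M G A) G = complex_of_real r"
    unfolding positive_representative_def by auto
qed

text \<open>The rotation \<open>z\<close> that moves the representative over \<open>A\<close> closest to the one over \<open>B\<close> has the
  argument of a complex number near the positive real \<open>r\<close>, where \<open>Arg\<close> is continuous with value
  \<open>0\<close>. Undoing \<open>z\<close> therefore costs little.\<close>

lemma continuous_map_positive_representative:
  assumes P: "prob_space M" and G: "G \<in> L_space M"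
  shows "continuous_map (subtopology (LQ_top M) (correlated_orbits M G)) (L_top M)
           (positive_representative M G)"
proof -
  interpret L: Metric_space "L_space M" "L_dist M" by (rule Metric_space_L) fact
  interpret Q: Metric_space "LQ_space M" "LQ_dist M" by (rule Metric_space_LQ) fact
  let ?U = "correlated_orbits M G" and ?s = "positive_representative M G"
  have UQ: "A \<in> LQ_space M" if "A \<in> ?U" for A using that by (simp add: correlated_orbits_def)
  have sL: "?s A \<in> L_space M" if "A \<in> ?U" for A
    using LQ_space_elem(1)[OF UQ[OF that] positive_representative(1)[OF G that]] .
  have modulus: "\<exists>\<delta>>0. \<forall>A\<in>?U. LQ_dist M B A < \<delta> \<longrightarrow> L_dist M (?s B) (?s A) < \<epsilon>"
    if B: "B \<in> ?U" and \<epsilon>: "0 < \<epsilon>" for B \<epsilon>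
  proof -
    obtain r where r: "0 < r" "correlation M (?s B) G = complex_of_real r"
      using positive_representative(2)[OF G B] by blast
    have "isCont Arg (complex_of_real r)"
      using r by (intro continuous_at_Arg) (simp add: complex_nonpos_Reals_iff)
    then obtain d where d: "0 < d"
      "\<And>w. norm (w - complex_of_real r) < d \<Longrightarrow> \<bar>Arg w\<bar> < pi * \<epsilon> / 2"
      using \<epsilon> r(1) unfolding continuous_at_eps_delta dist_norm
      by (auto simp: Arg_of_real dest!: spec[where x = "pi * \<epsilon> / 2"])
    (* The bound d / pi controls the phase of the rotation, the bound \<epsilon> / 2 the distance left after
       rotating; the triangle inequality adds the two halves of \<epsilon>. *)
    define \<delta> where "\<delta> = min (d / pi) (\<epsilon> / 2)"
    have "L_dist M (?s B) (?s A) < \<epsilon>" if A: "A \<in> ?U" and AB: "LQ_dist M B A < \<delta>" for A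
    proof -
      obtain z where z: "z \<in> sphere 0 1" "LQ_dist M A B = L_dist M (L_act z (?s A)) (?s B)"
        by (rule LQ_dist_attained_by_elements[OF P UQ[OF A] UQ[OF B]
              positive_representative(1)[OF G A] positive_representative(1)[OF G B]])
      have zA: "L_act z (?s A) \<in> L_space M" by (rule L_act_in_L_space[OF z(1) sL[OF A]])
      have close: "L_dist M (L_act z (?s A)) (?s B) < \<delta>" using AB z(2) by (simp add: Q.commute)
      obtain q where q: "0 < q" "correlation M (?s A) G = complex_of_real q"
        using positive_representative(2)[OF G A] by blast
      have "norm (z * complex_of_real q - complex_of_real r) \<le> pi * L_dist M (L_act z (?s A)) (?s B)"
        using correlation_lipschitz[OF P zA sL[OF B] G] correlation_L_act[OF z(1) sL[OF A] G] q r
        by simp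
      also have "\<dots> < d" using close by (simp add: \<delta>_def field_simps)
      finally have "\<bar>Arg (z * complex_of_real q)\<bar> < pi * \<epsilon> / 2" by (rule d(2))
      then have "\<bar>Arg z\<bar> < pi * \<epsilon> / 2" using q by (simp add: Arg_times_of_real2)
      then have "arc_dist 1 z < \<epsilon> / 2" by (simp add: arc_dist_def field_simps)
      moreover have "L_dist M (L_act z (?s A)) (?s A) = arc_dist 1 z"
        using L_dist_L_act_same[OF P _ z(1) sL[OF A], of 1]
        by (simp add: L_act_1 L_dist_commute)
      moreover have "L_dist M (?s B) (?s A) \<le>
          L_dist M (?s B) (L_act z (?s A)) + L_dist M (L_act z (?s A)) (?s A)"
        by (rule L.triangle[OF sL[OF B] zA sL[OF A]])
      ultimately show ?thesis
        using close by (simp add: \<delta>_def L_dist_commute)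
    qed
    moreover have "0 < \<delta>" using d \<epsilon> by (simp add: \<delta>_def)
    ultimately show ?thesis by blast
  qed
  show ?thesis
    unfolding L_top_def L.continuous_map_to_metric
  proof (intro ballI allI impI)
    fix B and \<epsilon> :: real
    assume B: "B \<in> topspace (subtopology (LQ_top M) ?U)" and "0 < \<epsilon>"
    then have BU: "B \<in> ?U" by simp
    then obtain \<delta> where \<delta>: "0 < \<delta>" "\<forall>A\<in>?U. LQ_dist M B A < \<delta> \<longrightarrow> L_dist M (?s B) (?s A) < \<epsilon>"
      using modulus \<open>0 < \<epsilon>\<close> by blast
    have "openin (subtopology (LQ_top M) ?U) (?U \<inter> Q.mball B \<delta>)"
      by (auto simp: openin_subtopology LQ_top_def intro!: exI[of _ "Q.mball B \<delta>"])
    moreover have "B \<in> ?U \<inter> Q.mball B \<delta>" using BU UQ \<delta>(1) by simp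
    moreover have "\<forall>A\<in>?U \<inter> Q.mball B \<delta>. ?s A \<in> L.mball (?s B) \<epsilon>"
      using \<delta>(2) sL BU by auto
    ultimately show "\<exists>V. openin (subtopology (LQ_top M) ?U) V \<and> B \<in> V \<and>
        (\<forall>A\<in>V. ?s A \<in> L.mball (?s B) \<epsilon>)" by blast
  qed
qed

theorem proposition6p4:
  fixes M :: "'a measure"
  assumes "prob_space M"
    and "standard_borel M"
    and "uncountable (space M)"
    and "nonatomic M"
  shows "\<forall>x \<in> LQ_space M. \<exists>U. openin (LQ_top M) U \<and> x \<in> U \<and>
           (\<exists>s. continuous_map (subtopology (LQ_top M) U) (L_top M) s \<and>
                (\<forall>y\<in>U. L_proj (s y) = y))"
proof
  fix x assume x: "x \<in> LQ_space M"
  then obtain G where G: "G \<in> L_space M" "x = L_proj G" by (auto simp: LQ_space_def)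
  let ?U = "correlated_orbits M G" and ?s = "positive_representative M G"
  have "correlation M F G \<noteq> 0" if F: "F \<in> x" for F
  proof -
    obtain z where z: "z \<in> sphere 0 1" "F = L_act z G"
      using F unfolding G(2) L_proj_def by blast
    then have "correlation M F G = z"
      using correlation_L_act[OF z(1) G(1) G(1)] correlation_self[OF assms(1) G(1)] by simp
    then show ?thesis using z(1) by auto
  qed
  then have "x \<in> ?U" using x by (simp add: correlated_orbits_def)
  moreover have "L_proj (?s y) = y" if "y \<in> ?U" for y
    using LQ_space_elem(2)[of y M "?s y"] positive_representative(1)[OF G(1) that] that
    by (simp add: correlated_orbits_def)
  ultimately show "\<exists>U. openin (LQ_top M) U \<and> x \<in> U \<and>
      (\<exists>s. continuous_map (subtopology (LQ_top M) U) (L_top M) s \<and> (\<forall>y\<in>U. L_proj (s y) = y))"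
    using openin_correlated_orbits[OF assms(1) G(1)]
      continuous_map_positive_representative[OF assms(1) G(1)] by blast
qed

end
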